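(* Let $\ell\ge 3$. Among all anchor-decodable sequences $s_\ell$ of length $\ell$, the sequence $f_\ell$ maximizes $k(s_\ell)=\sum_{i=1}^{\ell}s_\ell(i)$. (That is, $f_\ell$ is anchor-decodable and $k(s_\ell)\le k(f_\ell)$ for every anchor-decodable sequence $s_\ell$ of length $\ell$.)
   Context: For a vector $\mathbf{g}=(g[0],\dots,g[\ell-1])$ and an integer $\ell_0$ (taken mod $\ell$), $\mathrm{cshift}(\mathbf{g},\ell_0)=(g[\ell_0],g[\ell_0+1],\dots,g[\ell-1],g[0],\dots,g[\ell_0-1])$. Anchor-decodable: let $\ell\ge3$. A non-decreasing sequence of non-negative integers $s_\ell=(s_\ell(1),\dots,s_\ell(\ell))$ is anchor-decodable if $s_\ell(\ell)=\ell$ and (1) $2^\ell-\sum_{i=1}^{\ell-1}2^{s_\ell(i)}\ \ge\ 2^{s_\ell(\ell-1)}$; (2) the vector $\boldsymbol\gamma=\left(2^\ell-1-\sum_{i=1}^{\ell-1}2^{s_\ell(i)},\ 2^{s_\ell(\ell-1)}-1,\ 2^{s_\ell(\ell-2)}-1,\dots,2^{s_\ell(1)}-1\right)$ satisfies $\mathrm{cshift}(\boldsymbol\gamma,\ell_0)\ne\boldsymbol\gamma$ for every integer $0<\ell_0<\ell$. The sequence $f_\ell$: if $\ell$ is not a power of $2$, put $\mu = 2^{\lceil \log_2 \ell\rceil} - \ell$ and $f_\ell(i) = \ell - \lceil \log_2\ell\rceil$ for $1\le i\le \ell-\mu$; $f_\ell(i) = \ell - \lfloor \log_2\ell\rfloor$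 for $\ell-\mu+1\le i\le \ell-1$; $f_\ell(\ell)=\ell$. If $\ell$ is a power of $2$, put $f_\ell(1) = \ell-\log_2\ell-1$; $f_\ell(i)=\ell-\log_2\ell$ for $2\le i\le \ell-1$; $f_\ell(\ell)=\ell$. *)

theory Defs
  imports Complex_Main
begin

definition cshift :: "'a list \<Rightarrow> int \<Rightarrow> 'a list" where
  "cshift g l0 = rotate (nat (l0 mod int (length g))) g"

text \<open>A sequence of length \<open>l\<close> is a function on indices \<open>1, \<dots>, l\<close>; values at other
  arguments are irrelevant. The vector below is integer-valued, since its first
  entry may be negative for an arbitrary sequence.\<close>

definition gamma_vec :: "nat \<Rightarrow> (nat \<Rightarrow> nat) \<Rightarrow> int list" where
  "gamma_vec l s =
     (2 ^ l - 1 - (\<Sum>i=1..l-1. 2 ^ s i)) # map (\<lambda>i. 2 ^ s i - 1) (rev [1..<l])"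

definition anchor_decodable :: "nat \<Rightarrow> (nat \<Rightarrow> nat) \<Rightarrow> bool" where
  "anchor_decodable l s \<longleftrightarrow>
     mono_on {1..l} s \<and> s l = l \<and>
     (2::int) ^ l - (\<Sum>i=1..l-1. 2 ^ s i) \<ge> 2 ^ s (l - 1) \<and>
     (\<forall>l0::int. 0 < l0 \<and> l0 < int l \<longrightarrow> cshift (gamma_vec l s) l0 \<noteq> gamma_vec l s)"

definition k_sum :: "nat \<Rightarrow> (nat \<Rightarrow> nat) \<Rightarrow> nat" where
  "k_sum l s = (\<Sum>i=1..l. s i)"

text \<open>For \<open>l \<ge> 3\<close> no subtraction on natural numbers below truncates at an index in
  \<open>1, \<dots>, l\<close>. If \<open>l\<close> is a power of two, the floor of \<open>log 2 l\<close> is \<open>log 2 l\<close> itself.\<close>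

definition f_seq :: "nat \<Rightarrow> nat \<Rightarrow> nat" where
  "f_seq l i =
     (let c = nat \<lceil>log 2 (real l)\<rceil>; d = nat \<lfloor>log 2 (real l)\<rfloor>; \<mu> = 2 ^ c - l in
      if \<exists>m. l = 2 ^ m then
        (if i = l then l
         else if i = 1 then l - d - 1
         else l - d)
      else
        (if i = l then l
         else if i \<le> l - \<mu> then l - c
         else l - d))"

end

theory Submission
  imports Defs
begin

text \<open>For integers \<open>x\<close> and \<open>t\<close>, the power \<open>2^x\<close> lies above the chord \<open>2^t (x - t + 1)\<close> through the
  points at \<open>t\<close> and \<open>t + 1\<close>. Condition (1) bounds the sum of the \<open>l\<close> powers
  \<open>2^s(1), \<dots>, 2^s(l-1), 2^s(l-1)\<close> by \<open>2^l\<close>, so summing the chord inequality with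
  \<open>t = l - \<lfloor>log 2 l\<rfloor> - 1\<close> bounds \<open>s(1) + \<dots> + s(l-1) + s(l-1)\<close>. If \<open>s(l-1) > t\<close>, this is the
  required bound, and otherwise all entries before the last are at most \<open>t\<close>.
  When \<open>l\<close> is a power of two, the chord bound exceeds the value of \<open>f\<close> by one. The only
  sequence attaining it is constant before the last entry, and its vector \<open>\<gamma>\<close> is constant,
  contrary to condition (2).\<close>

section \<open>Cyclic shifts and the vector \<gamma>\<close>

lemma rotate_neq_if_separated:
  assumes a: "0 < a" "a < length g" and n: "0 < n" "n < length g"
    and sep: "\<And>i j. i < a \<Longrightarrow> a \<le> j \<Longrightarrow> j < length g \<Longrightarrow> g ! i \<noteq> g ! j"
  shows "rotate n g \<noteq> g"
proof
  assume rot: "rotate n g = g"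
  have shift: "g ! i = g ! (i + n)" if "i + n < length g" for i
    using nth_rotate[of i g n] rot that by (simp add: add.commute)
  \<comment> \<open>Rotation invariance equates any two entries at distance \<open>n\<close>. One
    such pair straddles the cut at \<open>a\<close>: positions \<open>a - n\<close> and
    \<open>a\<close> if \<open>n < a\<close>, and \<open>0\<close> and \<open>n\<close>
    otherwise.\<close>
  show False
  proof (cases "n < a")
    case True
    then show ?thesis using shift[of "a - n"] sep[of "a - n" a] a n by auto
  next
    case False
    then show ?thesis using shift[of 0] sep[of 0 n] a n by auto
  qed
qed

lemma cshift_neq_if_separated:
  assumes "0 < a" "a < length g"
    and "\<And>i j. i < a \<Longrightarrow> a \<le> j \<Longrightarrow> j < length g \<Longrightarrow> g ! i \<noteq> g ! j"
    and "0 < l0" "l0 < int (length g)"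
  shows "cshift g l0 \<noteq> g"
  unfolding cshift_def using assms
  by (intro rotate_neq_if_separated[of a]) auto

lemma length_gamma_vec: "0 < l \<Longrightarrow> length (gamma_vec l s) = l"
  by (simp add: gamma_vec_def)

lemma gamma_vec_nth_0: "gamma_vec l s ! 0 = 2 ^ l - 1 - (\<Sum>i=1..l-1. 2 ^ s i)"
  by (simp add: gamma_vec_def)

lemma gamma_vec_nth:
  assumes "0 < j" "j < l"
  shows "gamma_vec l s ! j = 2 ^ s (l - j) - 1"
  using assms by (cases j) (auto simp: gamma_vec_def rev_nth Suc_diff_Suc)

text \<open>This turns the extremal case for powers of two into a violation of condition (2):
  \<open>total\<close> makes the first entry of \<gamma> agree with all the others.\<close>

lemma cshift_gamma_vec_const:
  assumes const: "\<And>i. i \<in> {1..l-1} \<Longrightarrow> s i = c"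
    and total: "2 ^ l - (\<Sum>i=1..l-1. 2 ^ s i) = (2 ^ c :: int)" and "0 < l"
  shows "cshift (gamma_vec l s) l0 = gamma_vec l s"
proof -
  have "gamma_vec l s = replicate l (2 ^ c - 1)"
  proof (rule nth_equalityI)
    fix j assume "j < length (gamma_vec l s)"
    moreover from this have "s (l - j) = c" if "0 < j"
      using that \<open>0 < l\<close> by (intro const) (auto simp: length_gamma_vec)
    ultimately show "gamma_vec l s ! j = replicate l (2 ^ c - 1) ! j"
      using total \<open>0 < l\<close>
      by (cases "j = 0") (simp_all add: length_gamma_vec gamma_vec_nth gamma_vec_nth_0)
  qed (use assms in \<open>simp add: length_gamma_vec\<close>)
  moreover have "rotate n (replicate l x) = replicate l x" for n and x :: int
    by (rule nth_equalityI) (auto simp: nth_rotate)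
  ultimately show ?thesis by (simp add: cshift_def)
qed

section \<open>The chord inequality and its equality case\<close>

lemma chord_le_power2: "2 ^ t * (int x - int t + 1) \<le> 2 ^ x"
proof (cases "t \<le> x")
  case True
  then obtain d where x: "x = t + d" using le_Suc_ex by blast
  have "int d + 1 \<le> 2 ^ d"
    using less_exp[of d] by (metis Suc_leI of_nat_Suc of_nat_le_iff of_nat_numeral of_nat_power add.commute)
  then show ?thesis by (simp add: x power_add)
next
  case False
  then have "2 ^ t * (int x - int t + 1) \<le> 0" by (intro mult_nonneg_nonpos) auto
  also have "\<dots> \<le> 2 ^ x" by simp
  finally show ?thesis .
qed

text \<open>The chord meets the power exactly at \<open>t\<close> and \<open>t + 1\<close>, so for
  such exponents the sum of powers can be read off from the sum of exponents. This gives the first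
  entry of \<gamma> for \<open>f_seq\<close>.\<close>

lemma sum_power2_two_values:
  assumes "finite A" "\<And>i. i \<in> A \<Longrightarrow> s i = t \<or> s i = Suc t"
  shows "(\<Sum>i\<in>A. 2 ^ s i) = 2 ^ t * ((\<Sum>i\<in>A. int (s i)) - int (card A) * (int t - 1))"
proof -
  have "(\<Sum>i\<in>A. 2 ^ s i) = (\<Sum>i\<in>A. 2 ^ t * (int (s i) - (int t - 1)))"
    by (rule sum.cong) (use assms in \<open>force simp: algebra_simps\<close>)+
  also have "\<dots> = 2 ^ t * ((\<Sum>i\<in>A. int (s i)) - int (card A) * (int t - 1))"
    by (simp add: sum_distrib_left[symmetric] sum_subtractf)
  finally show ?thesis .
qed

section \<open>Closed forms of \<open>f_seq\<close>\<close>

lemma f_seq_power2: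
  "f_seq (2 ^ m) i =
     (if i = 2 ^ m then 2 ^ m else if i = 1 then 2 ^ m - m - 1 else 2 ^ m - m)"
  by (auto simp: f_seq_def Let_def log_nat_power)

lemma f_seq_not_power2:
  assumes "2 ^ m < l" "l < 2 ^ (m + 1)"
  shows "f_seq l i =
     (if i = l then l else if i \<le> l - (2 ^ (m + 1) - l) then l - m - 1 else l - m)"
proof -
  have "\<nexists>n. l = 2 ^ n"
  proof
    assume "\<exists>n. l = 2 ^ n"
    then obtain n where "l = 2 ^ n" ..
    with assms have "m < n" "n < m + 1" by (auto simp only: power_strict_increasing_iff one_less_numeral_iff semiring_norm)
    then show False by simp
  qed
  moreover have "\<lfloor>log 2 (real l)\<rfloor> = int m"
    using assms floor_log_nat_eq_if[of 2 m l] by simp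
  moreover have "\<lceil>log 2 (real l)\<rceil> = int m + 1"
    using assms ceiling_log_nat_eq_if[of 2 m l] by simp
  ultimately show ?thesis by (simp add: f_seq_def Let_def nat_add_distrib)
qed

section \<open>Upper bounds for anchor-decodable sequences\<close>

lemma k_sum_last: "0 < l \<Longrightarrow> int (k_sum l s) = (\<Sum>i=1..l-1. int (s i)) + int (s l)"
  by (cases l) (simp_all add: k_sum_def)

text \<open>The right-hand side of condition (1) supplies the second copy of
  \<open>s (l - 1)\<close>. Since \<open>2^l = 2^t * 2^(m+1)\<close>, the common factor
  \<open>2^t\<close> cancels.\<close>

lemma anchor_decodable_chord_bound:
  assumes "anchor_decodable l s" "l = t + m + 1"
  shows "(\<Sum>i=1..l-1. int (s i)) + int (s (l - 1)) \<le> 2 ^ (m + 1) + int l * (int t - 1)"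
proof -
  let ?S = "\<Sum>i=1..l-1. int (s i)"
  have "2 ^ t * (?S - int (l - 1) * (int t - 1)) = (\<Sum>i=1..l-1. 2 ^ t * (int (s i) - int t + 1))"
    by (simp add: sum_distrib_left[symmetric] sum_subtractf sum.distrib) (simp add: algebra_simps)
  also have "\<dots> \<le> (\<Sum>i=1..l-1. 2 ^ s i)"
    by (intro sum_mono chord_le_power2)
  also have "\<dots> \<le> 2 ^ l - 2 ^ s (l - 1)"
    using assms by (simp add: anchor_decodable_def)
  also have "\<dots> \<le> 2 ^ t * 2 ^ (m + 1) - 2 ^ t * (int (s (l - 1)) - int t + 1)"
    using chord_le_power2[of t "s (l - 1)"] assms by (simp add: power_add)
  finally have "2 ^ t * (?S - int (l - 1) * (int t - 1)) \<le> 2 ^ t * (2 ^ (m + 1) - (int (s (l - 1)) - int t + 1))"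
    by (simp only: right_diff_distrib)
  then have "?S - int (l - 1) * (int t - 1) \<le> 2 ^ (m + 1) - (int (s (l - 1)) - int t + 1)"
    by (rule mult_left_le_imp_le) simp
  then show ?thesis using assms(2) by (simp add: algebra_simps)
qed

lemma anchor_decodable_le_penultimate:
  assumes "anchor_decodable l s" "i \<in> {1..l-1}"
  shows "s i \<le> s (l - 1)"
  using assms by (auto simp: anchor_decodable_def dest!: mono_onD[where r = i and s = "l - 1"])

lemma anchor_decodable_sum_le:
  assumes "anchor_decodable l s" "s (l - 1) \<le> c" "0 < l"
  shows "(\<Sum>i=1..l-1. int (s i)) \<le> (int l - 1) * int c"
proof -
  have "int (s i) \<le> int c" if "i \<in> {1..l-1}" for i
    using anchor_decodable_le_penultimate[OF assms(1) that] assms(2) by simp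
  then have "(\<Sum>i=1..l-1. int (s i)) \<le> of_nat (card {1..l-1}) * int c"
    by (rule sum_bounded_above)
  then show ?thesis using assms(3) by (simp add: of_nat_diff)
qed

text \<open>Equality would force every entry before the last to be \<open>t + 1\<close>. As
  \<open>2^l = l * 2^(t+1)\<close>, the first entry of \<gamma> would then be
  \<open>2^(t+1) - 1\<close> too, and \<gamma> would be fixed by a shift by one.\<close>

lemma power2_not_attained:
  assumes ad: "anchor_decodable l s" and l: "l = t + m + 1" "l = 2 ^ m" "1 < l"
    and pen: "s (l - 1) = t + 1"
  shows "(\<Sum>i=1..l-1. int (s i)) < (int l - 1) * int (t + 1)"
proof (rule ccontr)
  let ?S = "\<Sum>i=1..l-1. int (s i)"
  assume "\<not> ?thesis"
  then have eq: "?S = (int l - 1) * int (t + 1)"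
    using anchor_decodable_sum_le[OF ad, of "t + 1"] l pen by simp
  have le: "int (s i) \<le> int (t + 1)" if "i \<in> {1..l-1}" for i
    using anchor_decodable_le_penultimate[OF ad that] pen by simp
  have "?S = (\<Sum>i=1..l-1. int (t + 1))"
    using eq l by (simp add: of_nat_diff)
  then have const: "s i = t + 1" if "i \<in> {1..l-1}" for i
    using sum_mono_inv[of "\<lambda>i. int (s i)" "{1..l-1}" "\<lambda>_. int (t + 1)" i] le that by simp
  have two: "(2::int) ^ l = 2 ^ (t + 1) * int l"
    by (subst (1) l(1), subst l(2)) (simp add: power_add)
  have "(\<Sum>i=1..l-1. (2::int) ^ s i) = (\<Sum>i=1..l-1. 2 ^ (t + 1))"
    by (rule sum.cong) (simp_all add: const)
  also have "\<dots> = (int l - 1) * 2 ^ (t + 1)"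
    using l(3) by (simp add: of_nat_diff)
  finally have "2 ^ l - (\<Sum>i=1..l-1. 2 ^ s i) = (2 ^ (t + 1) :: int)"
    using two by (simp add: algebra_simps)
  then have "cshift (gamma_vec l s) 1 = gamma_vec l s"
    using const l(3) by (intro cshift_gamma_vec_const) auto
  then show False using ad l(3) by (auto simp: anchor_decodable_def)
qed

section \<open>The sum of \<open>f_seq\<close> and its anchor-decodability\<close>

lemma sum_f_seq_power2:
  assumes "l = t + m + 1" "l = 2 ^ m" "3 \<le> l"
  shows "(\<Sum>i=1..l-1. int (f_seq l i)) = (int l - 1) * int (t + 1) - 1"
proof -
  have "(\<Sum>i=1..l-1. int (f_seq l i)) = (\<Sum>i=1..l-1. int (t + 1) - (if i = 1 then 1 else 0))"
    by (rule sum.cong) (use assms f_seq_power2[of m] in auto)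
  then show ?thesis using assms(3) by (simp add: sum_subtractf of_nat_diff)
qed

lemma sum_f_seq_not_power2:
  assumes "l = t + m + 1" "2 ^ m < l" "l < 2 ^ (m + 1)"
  shows "(\<Sum>i=1..l-1. int (f_seq l i)) = (int l - 1) * int t + (2 ^ (m + 1) - int l - 1)"
proof -
  \<comment> \<open>\<open>p = l - \<mu>\<close> is the last index with value \<open>t\<close>; the
    \<open>\<mu> - 1\<close> indices from \<open>p + 1\<close> to \<open>l - 1\<close> have value
    \<open>t + 1\<close>.\<close>
  define p where "p = l - (2 ^ (m + 1) - l)"
  have p: "p < l" "int p = 2 * int l - 2 ^ (m + 1)"
    using assms by (auto simp: p_def of_nat_diff)
  have "(\<Sum>i=1..l-1. int (f_seq l i)) = (\<Sum>i=1..l-1. int t + (if i \<in> {p<..} then 1 else 0))"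
    by (rule sum.cong) (use assms f_seq_not_power2[of m l] in \<open>auto simp: p_def\<close>)
  also have "\<dots> = (int l - 1) * int t + int (card ({1..l-1} \<inter> {p<..}))"
    using p(1) by (simp add: sum.distrib of_nat_diff sum.If_cases Int_def)
  also have "{1..l-1} \<inter> {p<..} = {p<..l-1}" by auto
  finally show ?thesis using p by (simp add: of_nat_diff)
qed

lemma anchor_decodable_f_seq_power2:
  assumes l: "l = t + m + 1" "l = 2 ^ m" "3 \<le> l"
  shows "anchor_decodable l (f_seq l)"
proof -
  let ?f = "f_seq l"
  have f: "?f i = (if i = l then l else if i = 1 then t else t + 1)" for i
    using f_seq_power2[of m i] l by auto
  have two: "(2::int) ^ l = 2 ^ t * (2 * int l)"
    by (subst (1) l(1), subst l(2)) (simp add: power_add)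
  have "(\<Sum>i=1..l-1. 2 ^ ?f i)
      = 2 ^ t * ((\<Sum>i=1..l-1. int (?f i)) - int (card {1..l-1}) * (int t - 1))"
    by (rule sum_power2_two_values) (use l(3) in \<open>auto simp: f\<close>)
  also have "\<dots> = 2 ^ t * (2 * int l - 3)"
    using l(3) unfolding sum_f_seq_power2[OF l] by (simp add: of_nat_diff algebra_simps)
  finally have rest: "2 ^ l - (\<Sum>i=1..l-1. 2 ^ ?f i) = (2 ^ t * 3 :: int)"
    by (simp add: two algebra_simps)
  \<comment> \<open>The first entry of \<gamma> is \<open>3 * 2^t - 1\<close>, while all others are
    \<open>2^t - 1\<close> or \<open>2^(t+1) - 1\<close>, so a cut after the first position
    separates.\<close>
  have "cshift (gamma_vec l ?f) l0 \<noteq> gamma_vec l ?f" if "0 < l0" "l0 < int l" for l0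
  proof (rule cshift_neq_if_separated[of 1])
    fix i j :: nat assume "i < 1" "1 \<le> j" "j < length (gamma_vec l ?f)"
    then show "gamma_vec l ?f ! i \<noteq> gamma_vec l ?f ! j"
      using rest l(3) by (auto simp: gamma_vec_nth_0 gamma_vec_nth length_gamma_vec f)
  qed (use that l(3) in \<open>auto simp: length_gamma_vec\<close>)
  moreover have "mono_on {1..l} ?f" unfolding mono_on_def f using l(1) by auto
  moreover have "2 ^ l - (\<Sum>i=1..l-1. 2 ^ ?f i) \<ge> (2 ^ ?f (l - 1) :: int)"
    unfolding rest using l(3) by (auto simp: f)
  ultimately show ?thesis by (simp add: anchor_decodable_def f)
qed

lemma anchor_decodable_f_seq_not_power2:
  assumes l: "l = t + m + 1" "2 ^ m < l" "l < 2 ^ (m + 1)"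
  shows "anchor_decodable l (f_seq l)"
proof -
  let ?f = "f_seq l"
  define \<mu> where "\<mu> = 2 ^ (m + 1) - l"
  have \<mu>: "0 < \<mu>" "\<mu> < l" "int \<mu> = 2 ^ (m + 1) - int l"
    using l by (auto simp: \<mu>_def of_nat_diff)
  have f: "?f i = (if i = l then l else if i \<le> l - \<mu> then t else t + 1)" for i
    using f_seq_not_power2[OF l(2,3), of i] l(1) by (auto simp: \<mu>_def)
  have two: "(2::int) ^ l = 2 ^ t * 2 ^ (m + 1)"
    by (simp add: l(1) power_add)
  have "(\<Sum>i=1..l-1. 2 ^ ?f i)
      = 2 ^ t * ((\<Sum>i=1..l-1. int (?f i)) - int (card {1..l-1}) * (int t - 1))"
    by (rule sum_power2_two_values) (use \<mu> in \<open>auto simp: f\<close>)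
  also have "\<dots> = 2 ^ t * (2 ^ (m + 1) - 2)"
    using \<mu> unfolding sum_f_seq_not_power2[OF l] by (simp add: of_nat_diff algebra_simps)
  finally have rest: "2 ^ l - (\<Sum>i=1..l-1. 2 ^ ?f i) = (2 ^ (t + 1) :: int)"
    unfolding two by (simp add: algebra_simps)
  \<comment> \<open>By \<open>rest\<close> the first entry equals the \<open>\<mu> - 1\<close>
    larger ones that follow it, so \<gamma> is a block of \<open>\<mu>\<close> large entries
    followed by \<open>l - \<mu>\<close> small ones.\<close>
  have gamma: "gamma_vec l ?f ! j = (if j < \<mu> then 2 ^ (t + 1) - 1 else 2 ^ t - 1)" if "j < l" for j
    using that rest \<mu> by (cases "j = 0") (auto simp: gamma_vec_nth_0 gamma_vec_nth f)
  have "cshift (gamma_vec l ?f) l0 \<noteq> gamma_vec l ?f" if "0 < l0" "l0 < int l" for l0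
  proof (rule cshift_neq_if_separated[of \<mu>])
    fix i j :: nat assume "i < \<mu>" "\<mu> \<le> j" "j < length (gamma_vec l ?f)"
    then show "gamma_vec l ?f ! i \<noteq> gamma_vec l ?f ! j"
      using \<mu> by (simp add: gamma length_gamma_vec)
  qed (use that \<mu> in \<open>auto simp: length_gamma_vec\<close>)
  moreover have "mono_on {1..l} ?f" unfolding mono_on_def f using l(1) by auto
  moreover have "2 ^ l - (\<Sum>i=1..l-1. 2 ^ ?f i) \<ge> (2 ^ ?f (l - 1) :: int)"
    unfolding rest using \<mu> by (auto simp: f)
  ultimately show ?thesis by (simp add: anchor_decodable_def f)
qed

section \<open>Comparison with \<open>f_seq\<close>\<close>

lemma sum_le_sum_f_seq_power2:
  assumes ad: "anchor_decodable l s" and l: "l = t + m + 1" "l = 2 ^ m" "3 \<le> l"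
  shows "(\<Sum>i=1..l-1. int (s i)) \<le> (\<Sum>i=1..l-1. int (f_seq l i))"
proof -
  have two: "(2::int) ^ (m + 1) = 2 * int l" by (simp add: l(2))
  have chord: "(\<Sum>i=1..l-1. int (s i)) + int (s (l - 1)) \<le> 2 * int l + int l * (int t - 1)"
    using anchor_decodable_chord_bound[OF ad l(1)] unfolding two .
  \<comment> \<open>For a penultimate entry \<open>t + 1\<close> the chord bound leaves
    \<open>(l - 1) * (t + 1)\<close>, one too many, and condition (2) has to exclude equality. From
    \<open>t + 2\<close> on, the doubled penultimate entry saves that one.\<close>
  consider "s (l - 1) \<le> t" | "s (l - 1) = t + 1" | "t + 2 \<le> s (l - 1)" by linarith
  then have "(\<Sum>i=1..l-1. int (s i)) \<le> (int l - 1) * int (t + 1) - 1"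
  proof cases
    case 1
    then show ?thesis using anchor_decodable_sum_le[OF ad 1] l(3) by (simp add: algebra_simps)
  next
    case 2
    then show ?thesis using power2_not_attained[OF ad l(1,2)] l(3) by simp
  next
    case 3
    then show ?thesis using chord by (simp add: algebra_simps)
  qed
  then show ?thesis unfolding sum_f_seq_power2[OF l] .
qed

lemma sum_le_sum_f_seq_not_power2:
  assumes ad: "anchor_decodable l s" and l: "l = t + m + 1" "2 ^ m < l" "l < 2 ^ (m + 1)"
  shows "(\<Sum>i=1..l-1. int (s i)) \<le> (\<Sum>i=1..l-1. int (f_seq l i))"
proof (cases "s (l - 1) \<le> t")
  case True
  \<comment> \<open>The surplus \<open>2^(m+1) - l - 1\<close> of \<open>f_seq\<close> over the
    constant value \<open>t\<close> is therefore nonnegative.\<close>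
  have "int l < 2 ^ (m + 1)" using l(3) by (metis of_nat_less_iff of_nat_numeral of_nat_power)
  then show ?thesis
    using anchor_decodable_sum_le[OF ad True] l(1) unfolding sum_f_seq_not_power2[OF l] by simp
next
  case False
  \<comment> \<open>Subtracting \<open>t + 1\<close> from the chord bound gives exactly the sum of
    \<open>f_seq\<close>.\<close>
  then have "int t + 1 \<le> int (s (l - 1))" by simp
  then show ?thesis using anchor_decodable_chord_bound[OF ad l(1)]
    unfolding sum_f_seq_not_power2[OF l] by (simp add: algebra_simps)
qed

theorem theorem2p4:
  fixes l :: nat
  assumes "l \<ge> 3"
  shows "anchor_decodable l (f_seq l) \<and>
         (\<forall>s. anchor_decodable l s \<longrightarrow> k_sum l s \<le> k_sum l (f_seq l))"
proof -
  obtain m where m: "2 ^ m \<le> l" "l < 2 ^ (m + 1)"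
    using ex_power_ivl1[of 2 l] assms by auto
  have "m < 2 ^ m" by (rule less_exp)
  then have "m + 1 \<le> l" using m(1) by linarith
  \<comment> \<open>Here \<open>m\<close> is the floor of \<open>log 2 l\<close>; writing
    \<open>l\<close> as a sum avoids truncated subtraction in \<open>t = l - m - 1\<close>.\<close>
  then obtain t where l: "l = t + m + 1" by (metis add.assoc add.commute le_Suc_ex)
  have "anchor_decodable l (f_seq l) \<and> (\<forall>s. anchor_decodable l s \<longrightarrow>
      (\<Sum>i=1..l-1. int (s i)) \<le> (\<Sum>i=1..l-1. int (f_seq l i)))"
  proof (cases "l = 2 ^ m")
    case True
    then show ?thesis
      using anchor_decodable_f_seq_power2[OF l] sum_le_sum_f_seq_power2[OF _ l] assms by blast
  next
    case False
    then have "2 ^ m < l" using m(1) by simp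
    then show ?thesis
      using anchor_decodable_f_seq_not_power2[OF l] sum_le_sum_f_seq_not_power2[OF _ l] m(2) by blast
  qed
  moreover have "k_sum l s \<le> k_sum l (f_seq l)"
    if "anchor_decodable l s" "anchor_decodable l (f_seq l)"
      "(\<Sum>i=1..l-1. int (s i)) \<le> (\<Sum>i=1..l-1. int (f_seq l i))" for s
  proof -
    have "s l = f_seq l l" using that by (simp add: anchor_decodable_def)
    then have "int (k_sum l s) \<le> int (k_sum l (f_seq l))"
      using that(3) assms by (simp add: k_sum_last)
    then show ?thesis by simp
  qed
  ultimately show ?thesis by blast
qed

end
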